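(* For a triangle quadruple $Q$, let $\max(Q)$ denote its largest entry. Then the number of triangle quadruples $Q$ with $\max(Q)\le n$ is $O(n^2\log^3 n)$.
   Context: A triangle quadruple is a quadruple $(a,b,c,d)$ of nonnegative integers satisfying $3(a^2+b^2+c^2+d^2)=(a+b+c+d)^2$. *)

theory Defs
  imports Complex_Main "HOL-Library.Landau_Symbols"
begin

definition triangle_quadruple :: "nat \<times> nat \<times> nat \<times> nat \<Rightarrow> bool" where
  "triangle_quadruple = (\<lambda>(a, b, c, d).
     3 * (a\<^sup>2 + b\<^sup>2 + c\<^sup>2 + d\<^sup>2) = (a + b + c + d)\<^sup>2)"

definition max_entry :: "nat \<times> nat \<times> nat \<times> nat \<Rightarrow> nat" where
  "max_entry = (\<lambda>(a, b, c, d). Max {a, b, c, d})"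

end

theory Submission
  imports Defs "HOL-Computational_Algebra.Primes"
begin

text \<open>
  With \<open>p = (c + d - 2a - 2b) / 3\<close> and \<open>q = p - (d - a - b)\<close>, the defining equation becomes
  \<open>a b = p\<^sup>2 + p q + q\<^sup>2 = |z|\<^sup>2\<close> for the Eisenstein integer \<open>z = p + q \<omega>\<close>,
  \<open>\<omega> = exp (\<i> \<pi> / 3)\<close>. So the Hermitian matrix with diagonal \<open>a, b\<close> and off-diagonal entry \<open>z\<close>
  has rank at most one. As the Eisenstein integers are Euclidean, such a matrix is \<open>k\<close> times the outer
  product of an integral vector \<open>(u, v)\<close> with itself, for some integer \<open>k \<ge> 1\<close>. The entries
  are bounded by \<open>n\<close>, hence \<open>|u|\<^sup>2\<close> and \<open>|v|\<^sup>2\<close> are at most \<open>n / k\<close>, which leaves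
  \<open>O((n / k)\<^sup>2)\<close> choices of \<open>(u, v)\<close>. Summing over \<open>k\<close> gives even the bound \<open>O(n\<^sup>2)\<close>.
\<close>

section \<open>Eisenstein norm form and its outer squares\<close>

text \<open>The squared modulus of \<open>x + y * \<omega>\<close>; the mixed term has a plus sign
  because \<omega> has trace 1.\<close>

definition eis_norm :: "int \<Rightarrow> int \<Rightarrow> int" where
  "eis_norm x y = x\<^sup>2 + x * y + y\<^sup>2"

text \<open>
  Here \<open>a = k |u|\<^sup>2\<close>, \<open>b = k |v|\<^sup>2\<close> and \<open>p + q \<omega> = k u v'\<close> with \<open>v'\<close> the conjugate of \<open>v\<close>,
  written out in coordinates using \<open>\<omega>\<^sup>2 = \<omega> - 1\<close>.
\<close>

definition outer_square :: "int \<Rightarrow> int \<Rightarrow> int \<Rightarrow> int \<Rightarrow> bool" where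
  "outer_square a b p q \<longleftrightarrow> (\<exists>k u1 u2 v1 v2. k \<ge> 1 \<and>
     a = k * eis_norm u1 u2 \<and> b = k * eis_norm v1 v2 \<and>
     p = k * (u1 * v1 + u1 * v2 + u2 * v2) \<and> q = k * (u2 * v1 - u1 * v2))"

text \<open>Completing the square: 4 (x^2 + x y + y^2) = 3 x^2 + (x + 2 y)^2.\<close>

lemma eis_norm_ge_left: "3 * x\<^sup>2 \<le> 4 * eis_norm x y"
proof -
  have "0 \<le> (x + 2 * y)\<^sup>2" by simp
  then show ?thesis by (simp add: eis_norm_def power2_eq_square algebra_simps)
qed

lemma eis_norm_commute: "eis_norm x y = eis_norm y x"
  by (simp add: eis_norm_def)

lemma eis_norm_ge_right: "3 * y\<^sup>2 \<le> 4 * eis_norm x y"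
  using eis_norm_ge_left[of y x] by (simp add: eis_norm_commute)

lemma eis_norm_nonneg: "0 \<le> eis_norm x y"
  using eis_norm_ge_left[of x y] zero_le_power2[of x] by linarith

lemma eis_norm_eq_0_iff: "eis_norm x y = 0 \<longleftrightarrow> x = 0 \<and> y = 0"
proof
  assume "eis_norm x y = 0"
  then have "x\<^sup>2 \<le> 0" "y\<^sup>2 \<le> 0"
    using eis_norm_ge_left[of x y] eis_norm_ge_right[of y x] by simp_all
  then show "x = 0 \<and> y = 0" by simp
qed (simp add: eis_norm_def)

text \<open>Exchanging u and v conjugates z. The conjugate of \<omega> is 1 - \<omega>, so p + q
  \<omega> becomes (p + q) - q \<omega>.\<close>

lemma outer_square_swap:
  assumes "outer_square a b p q"
  shows "outer_square b a (p + q) (- q)"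
proof -
  obtain k u1 u2 v1 v2 where "k \<ge> 1"
    "a = k * eis_norm u1 u2" "b = k * eis_norm v1 v2"
    "p = k * (u1 * v1 + u1 * v2 + u2 * v2)" "q = k * (u2 * v1 - u1 * v2)"
    using assms unfolding outer_square_def by blast
  then show ?thesis
    unfolding outer_square_def
    by (intro exI[of _ k] exI[of _ v1] exI[of _ v2] exI[of _ u1] exI[of _ u2])
      (simp add: algebra_simps)
qed

text \<open>This is the effect on the matrix of replacing \<open>v\<close> by \<open>v + w' u\<close>, \<open>w'\<close> the conjugate of \<open>w\<close>.\<close>

lemma outer_square_shear:
  assumes "outer_square a b p q"
  shows "outer_square a (b + (2 * p * w1 + p * w2 + q * w1 + 2 * q * w2) + a * eis_norm w1 w2)
    (p + a * w1) (q + a * w2)"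
proof -
  obtain k u1 u2 v1 v2 where *: "k \<ge> 1"
    "a = k * eis_norm u1 u2" "b = k * eis_norm v1 v2"
    "p = k * (u1 * v1 + u1 * v2 + u2 * v2)" "q = k * (u2 * v1 - u1 * v2)"
    using assms unfolding outer_square_def by blast
  define v1' v2' where "v1' = v1 + (w1 * u1 + w2 * u1 + w2 * u2)"
    and "v2' = v2 + (w1 * u2 - w2 * u1)"
  have p': "u1 * v1' + u1 * v2' + u2 * v2' = (u1 * v1 + u1 * v2 + u2 * v2) + eis_norm u1 u2 * w1"
    and q': "u2 * v1' - u1 * v2' = (u2 * v1 - u1 * v2) + eis_norm u1 u2 * w2"
    unfolding v1'_def v2'_def eis_norm_def power2_eq_square by (simp_all add: algebra_simps)
  have b': "eis_norm v1' v2' = eis_norm v1 v2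
      + (2 * (u1 * v1 + u1 * v2 + u2 * v2) * w1 + (u1 * v1 + u1 * v2 + u2 * v2) * w2
        + (u2 * v1 - u1 * v2) * w1 + 2 * (u2 * v1 - u1 * v2) * w2)
      + eis_norm u1 u2 * eis_norm w1 w2"
    unfolding v1'_def v2'_def eis_norm_def power2_eq_square by (simp add: algebra_simps)
  show ?thesis
    unfolding outer_square_def
  proof (intro exI conjI)
    show "b + (2 * p * w1 + p * w2 + q * w1 + 2 * q * w2) + a * eis_norm w1 w2
        = k * eis_norm v1' v2'"
      unfolding b' *(2-5) by (simp only: ring_distribs mult.assoc mult.left_commute[of k 2])
    show "p + a * w1 = k * (u1 * v1' + u1 * v2' + u2 * v2')"
      unfolding p' *(2-5) by (simp only: distrib_left mult.assoc)
    show "q + a * w2 = k * (u2 * v1' - u1 * v2')"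
      unfolding q' *(2-5) by (simp only: distrib_left mult.assoc)
  qed (use * in simp_all)
qed

section \<open>Euclidean descent\<close>

lemma ex_nearest_multiple:
  fixes a p :: int
  assumes "a > 0"
  shows "\<exists>w. \<bar>2 * (p - a * w)\<bar> \<le> a"
proof
  \<comment> \<open>Rounding to nearest: this quotient is the floor of p / a + 1/2.\<close>
  let ?w = "(2 * p + a) div (2 * a)"
  have "2 * a * ?w + (2 * p + a) mod (2 * a) = 2 * p + a" by simp
  moreover have "0 \<le> (2 * p + a) mod (2 * a)" "(2 * p + a) mod (2 * a) < 2 * a"
    using assms by simp_all
  ultimately show "\<bar>2 * (p - a * ?w)\<bar> \<le> a"
    unfolding right_diff_distrib mult.assoc by linarith
qed

lemma outer_square_zero:
  assumes "b \<ge> 0"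
  shows "outer_square 0 b 0 0"
proof (cases "b = 0")
  case True
  then show ?thesis
    unfolding outer_square_def eis_norm_def
    by (intro exI[of _ 1] exI[of _ 0]) simp
next
  case False
  with assms show ?thesis
    unfolding outer_square_def eis_norm_def
    by (intro exI[of _ b] exI[of _ 0] exI[of _ 0] exI[of _ 1] exI[of _ 0]) simp
qed

text \<open>Descent on the trace \<open>a + b\<close>: a shear that rounds off z / a shrinks the
  larger diagonal entry, and the inverse shear carries the factorisation back.\<close>

lemma outer_square_of_norm:
  assumes "a \<ge> 0" "b \<ge> 0" "a * b = eis_norm p q"
  shows "outer_square a b p q"
  using assms
proof (induction "nat (a + b)" arbitrary: a b p q rule: less_induct)
  case less
  \<comment> \<open>Only the trace is tied to \<open>a\<close> and \<open>b\<close>, so the claim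
    serves both orders of the diagonal, the second one after a swap.\<close>
  have descent: "outer_square a' b' p' q'"
    if a': "0 < a'" "a' \<le> b'" and sum: "a' + b' = a + b" and norm: "a' * b' = eis_norm p' q'"
    for a' b' p' q'
  proof -
    obtain w1 w2 where w: "\<bar>2 * (p' - a' * w1)\<bar> \<le> a'" "\<bar>2 * (q' - a' * w2)\<bar> \<le> a'"
      using ex_nearest_multiple[OF a'(1)] by meson
    define r s where "r = p' - a' * w1" and "s = q' - a' * w2"
    \<comment> \<open>The second diagonal entry after the shear by \<open>(- w1, - w2)\<close>;
      \<open>norm''\<close> says that the determinant stays zero.\<close>
    define b'' where
      "b'' = b' - (2 * p' * w1 + p' * w2 + q' * w1 + 2 * q' * w2) + a' * eis_norm w1 w2"
    have "a' * b'' = eis_norm p' q' - a' * (2 * p' * w1 + p' * w2 + q' * w1 + 2 * q' * w2)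
        + a' * (a' * eis_norm w1 w2)"
      unfolding b''_def norm[symmetric] by (simp add: algebra_simps)
    then have norm'': "a' * b'' = eis_norm r s"
      unfolding r_def s_def by (simp add: eis_norm_def power2_eq_square algebra_simps)
    have "(2 * r)\<^sup>2 \<le> a'\<^sup>2" "(2 * s)\<^sup>2 \<le> a'\<^sup>2" "\<bar>2 * r\<bar> * \<bar>2 * s\<bar> \<le> a' * a'"
      using w a' unfolding r_def s_def
      by (simp_all add: abs_le_square_iff[symmetric] mult_mono del: abs_mult)
    \<comment> \<open>Both coordinates are at most a'/2 in absolute value, so each of the three
      terms of the norm is at most a'^2 / 4.\<close>
    then have "4 * eis_norm r s \<le> 3 * (a' * a')"
      using abs_ge_self[of "(2 * r) * (2 * s)"]
      by (simp add: eis_norm_def power2_eq_square abs_mult)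
    then have "a' * (4 * b'') \<le> a' * (3 * a')"
      using norm'' by (simp add: algebra_simps)
    then have "4 * b'' \<le> 3 * a'"
      using a'(1) by simp
    moreover have "0 \<le> b''"
      using norm'' eis_norm_nonneg[of r s] a'(1) by (metis zero_le_mult_iff not_less)
    \<comment> \<open>As \<open>b''\<close> is at most 3/4 of \<open>a'\<close>, it is less than
      \<open>b'\<close>, and the trace strictly decreases.\<close>
    ultimately have "outer_square a' b'' r s"
      using a' sum less.prems norm'' by (intro less.hyps) auto
    from outer_square_shear[OF this, of w1 w2]
    have "outer_square a' (b'' + (2 * r * w1 + r * w2 + s * w1 + 2 * s * w2) + a' * eis_norm w1 w2) p' q'"
      by (simp add: r_def s_def)
    moreover have "b'' + (2 * r * w1 + r * w2 + s * w1 + 2 * s * w2) + a' * eis_norm w1 w2 = b'"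
      unfolding b''_def r_def s_def by (simp add: eis_norm_def power2_eq_square algebra_simps)
    ultimately show ?thesis by simp
  qed
  consider "a = 0" | "b = 0" | "0 < a" "a \<le> b" | "0 < b" "b \<le> a"
    using less.prems by linarith
  then show ?case
  proof cases
    case 1
    with less.prems have "p = 0 \<and> q = 0" by (simp add: eis_norm_eq_0_iff[symmetric])
    with 1 less.prems show ?thesis by (simp add: outer_square_zero)
  next
    case 2
    with less.prems have "p = 0 \<and> q = 0" by (simp add: eis_norm_eq_0_iff[symmetric])
    with 2 less.prems show ?thesis
      using outer_square_swap[OF outer_square_zero[of a]] by simp
  next
    case 3
    then show ?thesis using less.prems descent by simp
  next
    case 4
    have "eis_norm p q = eis_norm (p + q) (- q)"
      by (simp add: eis_norm_def power2_eq_square algebra_simps)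
    with 4 have "outer_square b a (p + q) (- q)"
      using less.prems by (intro descent) (simp_all add: mult.commute)
    from outer_square_swap[OF this] show ?thesis by simp
  qed
qed

section \<open>Parametrisation of triangle quadruples\<close>

text \<open>The last two entries are k |u + v|^2 and k |\<omega> u + v|^2, so \<open>nat\<close>
  truncates nothing when \<open>k \<ge> 0\<close>.\<close>

definition quadruple_of :: "int \<Rightarrow> int \<times> int \<times> int \<times> int \<Rightarrow> nat \<times> nat \<times> nat \<times> nat" where
  "quadruple_of k = (\<lambda>(u1, u2, v1, v2).
     let a = k * eis_norm u1 u2; b = k * eis_norm v1 v2;
         p = k * (u1 * v1 + u1 * v2 + u2 * v2); q = k * (u2 * v1 - u1 * v2)
     in (nat a, nat b, nat (a + b + (2 * p + q)), nat (a + b + (p - q))))"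

lemma triangle_quadruple_param:
  assumes "triangle_quadruple (a, b, c, d)"
  obtains k u1 u2 v1 v2 where "k \<ge> 1" "int a = k * eis_norm u1 u2" "int b = k * eis_norm v1 v2"
    "(a, b, c, d) = quadruple_of k (u1, u2, v1, v2)"
proof -
  define X Y where "X = int c - int a - int b" and "Y = int d - int a - int b"
  have "3 * (a\<^sup>2 + b\<^sup>2 + c\<^sup>2 + d\<^sup>2) = (a + b + c + d)\<^sup>2"
    using assms by (simp add: triangle_quadruple_def)
  then have "int (3 * (a\<^sup>2 + b\<^sup>2 + c\<^sup>2 + d\<^sup>2)) = int ((a + b + c + d)\<^sup>2)"
    by (simp only:)
  then have "3 * ((int a)\<^sup>2 + (int b)\<^sup>2 + (int c)\<^sup>2 + (int d)\<^sup>2) = (int a + int b + int c + int d)\<^sup>2"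
    by simp
  moreover have cd: "int c = X + int a + int b" "int d = Y + int a + int b"
    by (simp_all add: X_def Y_def)
  ultimately have eq: "X\<^sup>2 - X * Y + Y\<^sup>2 = 3 * (int a * int b)"
    by (simp add: power2_eq_square algebra_simps)
  \<comment> \<open>Modulo 3 the form X^2 - X Y + Y^2 is (X + Y)^2; this is what makes
    \<open>p\<close> integral.\<close>
  have "(X + Y)\<^sup>2 = 3 * (int a * int b + X * Y)"
    using eq by (simp add: power2_eq_square algebra_simps)
  then have "3 dvd (X + Y)\<^sup>2" by simp
  then have "3 dvd X + Y"
    using prime_dvd_power[of 3 "X + Y" 2] by simp
  then obtain p where "X + Y = 3 * p" ..
  define q where "q = p - Y"
  have XY: "X = 2 * p + q" "Y = p - q"
    using \<open>X + Y = 3 * p\<close> by (simp_all add: q_def)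
  have "int a * int b = eis_norm p q"
    using eq unfolding XY by (simp add: eis_norm_def power2_eq_square algebra_simps)
  then have "outer_square (int a) (int b) p q"
    by (intro outer_square_of_norm) simp_all
  then obtain k u1 u2 v1 v2 where *: "k \<ge> 1"
    "int a = k * eis_norm u1 u2" "int b = k * eis_norm v1 v2"
    "p = k * (u1 * v1 + u1 * v2 + u2 * v2)" "q = k * (u2 * v1 - u1 * v2)"
    unfolding outer_square_def by blast
  have "a = nat (int a)" "b = nat (int b)"
    "c = nat (int a + int b + (2 * p + q))" "d = nat (int a + int b + (p - q))"
    using cd XY by simp_all
  then have "(a, b, c, d) = quadruple_of k (u1, u2, v1, v2)"
    unfolding quadruple_of_def Let_def prod.case *(2-5)[symmetric] by blast
  with *(1-3) show ?thesis by (rule that)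
qed

section \<open>Counting the parameters\<close>

text \<open>Completing the square bounds \<open>k\<close> x^2 by 4 n / 3 for the coordinates x of u
  and v; 2 n is a rounder upper bound.\<close>

definition small_ints :: "nat \<Rightarrow> nat \<Rightarrow> int set" where
  "small_ints n k = {x. int k * x\<^sup>2 \<le> 2 * int n}"

lemma small_ints_subset:
  assumes "k \<ge> 1"
  shows "small_ints n k \<subseteq> {- \<lfloor>sqrt (2 * real n / real k)\<rfloor>..\<lfloor>sqrt (2 * real n / real k)\<rfloor>}"
proof
  fix x assume "x \<in> small_ints n k"
  then have "real_of_int (int k * x\<^sup>2) \<le> real_of_int (2 * int n)"
    unfolding small_ints_def of_int_le_iff by simp
  then have "(real_of_int x)\<^sup>2 \<le> 2 * real n / real k"
    using assms by (simp add: field_simps)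
  then have "real_of_int \<bar>x\<bar> \<le> sqrt (2 * real n / real k)"
    using real_le_rsqrt[of "real_of_int \<bar>x\<bar>"] by simp
  then have "\<bar>x\<bar> \<le> \<lfloor>sqrt (2 * real n / real k)\<rfloor>"
    by (simp only: le_floor_iff)
  then show "x \<in> {- \<lfloor>sqrt (2 * real n / real k)\<rfloor>..\<lfloor>sqrt (2 * real n / real k)\<rfloor>}"
    by auto
qed

lemma finite_small_ints: "k \<ge> 1 \<Longrightarrow> finite (small_ints n k)"
  by (rule finite_subset[OF small_ints_subset]) simp_all

text \<open>\<open>k \<le> n\<close> makes the root t at least 1, so the count 2 t + 1 is at most 3
  t.\<close>

lemma card_small_ints_le:
  assumes "1 \<le> k" "k \<le> n"
  shows "real (card (small_ints n k)) \<le> 3 * sqrt (2 * real n / real k)"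
proof -
  let ?t = "sqrt (2 * real n / real k)"
  have "1 \<le> ?t" using assms by (simp add: field_simps)
  have "card (small_ints n k) \<le> card {- \<lfloor>?t\<rfloor>..\<lfloor>?t\<rfloor>}"
    using assms by (intro card_mono small_ints_subset) simp_all
  also have "\<dots> = nat (2 * \<lfloor>?t\<rfloor> + 1)"
    by simp
  finally have "real (card (small_ints n k)) \<le> real (nat (2 * \<lfloor>?t\<rfloor> + 1))"
    by (simp only: of_nat_le_iff)
  also have "\<dots> = 2 * real_of_int \<lfloor>?t\<rfloor> + 1"
    using \<open>1 \<le> ?t\<close> by (subst of_nat_nat) (simp_all add: le_floor_iff)
  also have "\<dots> \<le> 3 * ?t"
    using \<open>1 \<le> ?t\<close> of_int_floor_le[of ?t] by linarith
  finally show ?thesis .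
qed

text \<open>For \<open>n = 0\<close> this reads \<open>0 \<le> 2\<close>, as \<open>1 / 0 = 0\<close>.\<close>

lemma sum_inverse_squares_le: "(\<Sum>k = 1..n. 1 / (real k)\<^sup>2) \<le> 2 - 1 / real n"
proof (induction n)
  case 0
  then show ?case by simp
next
  case (Suc n)
  show ?case
  proof (cases "n = 0")
    case False
    then have "1 / (real (Suc n))\<^sup>2 \<le> 1 / (real n * real (Suc n))"
      unfolding power2_eq_square by (intro divide_left_mono mult_right_mono) simp_all
    also have "\<dots> = 1 / real n - 1 / real (Suc n)"
      using False by (simp add: field_simps)
    finally have "1 / (real (Suc n))\<^sup>2 \<le> 1 / real n - 1 / real (Suc n)" .
    moreover have "(\<Sum>k = 1..Suc n. 1 / (real k)\<^sup>2)
        = (\<Sum>k = 1..n. 1 / (real k)\<^sup>2) + 1 / (real (Suc n))\<^sup>2"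
      by (rule sum.cl_ivl_Suc[THEN trans]) simp
    ultimately show ?thesis using Suc.IH by linarith
  qed simp
qed

abbreviation parameters :: "nat \<Rightarrow> nat \<Rightarrow> (int \<times> int \<times> int \<times> int) set" where
  "parameters n k \<equiv> small_ints n k \<times> small_ints n k \<times> small_ints n k \<times> small_ints n k"

lemma mem_parameters:
  assumes "int k * eis_norm u1 u2 \<le> int n" "int k * eis_norm v1 v2 \<le> int n"
  shows "(u1, u2, v1, v2) \<in> parameters n k"
proof -
  have *: "x \<in> small_ints n k" if "3 * x\<^sup>2 \<le> 4 * N" "int k * N \<le> int n" for x N
  proof -
    have "int k * (3 * x\<^sup>2) \<le> int k * (4 * N)"
      using that(1) by (intro mult_left_mono) simp_all
    then have "3 * (int k * x\<^sup>2) \<le> 4 * int n"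
      using that(2) by simp
    then show ?thesis by (simp add: small_ints_def)
  qed
  show ?thesis
    using *[OF eis_norm_ge_left assms(1)] *[OF eis_norm_ge_right assms(1)]
      *[OF eis_norm_ge_left assms(2)] *[OF eis_norm_ge_right assms(2)] by simp
qed

lemma triangle_quadruples_subset:
  assumes "n \<ge> 1"
  shows "{Q. triangle_quadruple Q \<and> max_entry Q \<le> n}
    \<subseteq> (\<Union>k \<in> {1..n}. quadruple_of (int k) ` parameters n k)"
proof (intro subsetI)
  fix Q assume "Q \<in> {Q. triangle_quadruple Q \<and> max_entry Q \<le> n}"
  then obtain a b c d where Q: "Q = (a, b, c, d)" and tri: "triangle_quadruple (a, b, c, d)"
    and ab: "a \<le> n" "b \<le> n"
    by (cases Q) (auto simp: max_entry_def)
  obtain k u1 u2 v1 v2 where k: "k \<ge> 1"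
    and eqs: "int a = k * eis_norm u1 u2" "int b = k * eis_norm v1 v2"
    and Q_eq: "(a, b, c, d) = quadruple_of k (u1, u2, v1, v2)"
    using tri by (rule triangle_quadruple_param)
  have "\<exists>k' \<in> {1..n}. (u1, u2, v1, v2) \<in> parameters n k' \<and>
      quadruple_of k (u1, u2, v1, v2) = quadruple_of (int k') (u1, u2, v1, v2)"
  proof (cases "eis_norm u1 u2 = 0 \<and> eis_norm v1 v2 = 0")
    \<comment> \<open>The zero quadruple leaves \<open>k\<close> unbounded, so it is reassigned to
      1, which is in range as \<open>n \<ge> 1\<close>.\<close>
    case True
    then have "u1 = 0" "u2 = 0" "v1 = 0" "v2 = 0"
      by (simp_all add: eis_norm_eq_0_iff)
    then show ?thesis
      using assms by (intro bexI[of _ 1]) (simp_all add: quadruple_of_def small_ints_def eis_norm_def)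
  next
    case False
    \<comment> \<open>A nonzero vector has norm at least 1, which forces \<open>k\<close> below
      \<open>a\<close> or \<open>b\<close> and hence below \<open>n\<close>.\<close>
    then have "eis_norm u1 u2 \<ge> 1 \<or> eis_norm v1 v2 \<ge> 1"
      using eis_norm_nonneg[of u1 u2] eis_norm_nonneg[of v1 v2] by linarith
    then have "k * 1 \<le> int a \<or> k * 1 \<le> int b"
      unfolding eqs using k by (auto intro: mult_left_mono simp del: mult_1_right)
    then have "k \<le> int n" using ab by linarith
    with k have "nat k \<in> {1..n}" by auto
    with k ab eqs show ?thesis
      by (intro bexI[of _ "nat k"] conjI mem_parameters) simp_all
  qed
  then show "Q \<in> (\<Union>k \<in> {1..n}. quadruple_of (int k) ` parameters n k)"
    unfolding Q Q_eq by fastforce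
qed

text \<open>Each k contributes at most (3 sqrt (2 n / k))^4 = 324 n^2 / k^2 quadruples, and the
  inverse squares sum to at most 2.\<close>

lemma card_triangle_quadruples_le:
  assumes "n \<ge> 1"
  shows "real (card {Q. triangle_quadruple Q \<and> max_entry Q \<le> n}) \<le> 648 * (real n)\<^sup>2"
proof -
  have card_params: "real (card (quadruple_of (int k) ` parameters n k)) \<le> 324 * (real n)\<^sup>2 * (1 / (real k)\<^sup>2)"
    if "k \<in> {1..n}" for k
  proof -
    let ?t = "sqrt (2 * real n / real k)"
    have "card (quadruple_of (int k) ` parameters n k) \<le> card (parameters n k)"
      using that by (intro card_image_le) (simp add: finite_small_ints)
    also have "\<dots> = card (small_ints n k) ^ 4"
      by (simp add: card_cartesian_product numeral_eq_Suc)
    finally have "real (card (quadruple_of (int k) ` parameters n k)) \<le> real (card (small_ints n k)) ^ 4"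
      by (simp flip: of_nat_power)
    also have "\<dots> \<le> (3 * ?t) ^ 4"
      using that by (intro power_mono card_small_ints_le) simp_all
    also have "\<dots> = 81 * (?t\<^sup>2)\<^sup>2"
      unfolding power_mult_distrib power_mult[symmetric] by simp
    also have "\<dots> = 324 * (real n)\<^sup>2 * (1 / (real k)\<^sup>2)"
      by (simp add: power_divide power_mult_distrib)
    finally show ?thesis .
  qed
  have "card {Q. triangle_quadruple Q \<and> max_entry Q \<le> n}
      \<le> card (\<Union>k \<in> {1..n}. quadruple_of (int k) ` parameters n k)"
    using assms by (intro card_mono triangle_quadruples_subset) (auto simp: finite_small_ints)
  also have "\<dots> \<le> (\<Sum>k = 1..n. card (quadruple_of (int k) ` parameters n k))"
    by (intro card_UN_le) simp
  finally have "real (card {Q. triangle_quadruple Q \<and> max_entry Q \<le> n})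
      \<le> (\<Sum>k = 1..n. real (card (quadruple_of (int k) ` parameters n k)))"
    by (simp flip: of_nat_sum)
  also have "\<dots> \<le> (\<Sum>k = 1..n. 324 * (real n)\<^sup>2 * (1 / (real k)\<^sup>2))"
    by (intro sum_mono card_params)
  also have "\<dots> = 324 * (real n)\<^sup>2 * (\<Sum>k = 1..n. 1 / (real k)\<^sup>2)"
    by (simp only: sum_distrib_left)
  also have "\<dots> \<le> 324 * (real n)\<^sup>2 * 2"
    using sum_inverse_squares_le[of n]
    by (intro mult_left_mono) (auto intro: order_trans)
  finally show ?thesis by simp
qed

theorem theorem3:
  "(\<lambda>n::nat. real (card {Q. triangle_quadruple Q \<and> max_entry Q \<le> n}))
     \<in> O(\<lambda>n. (real n)\<^sup>2 * (ln (real n)) ^ 3)"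
proof (rule bigoI[where c = 648])
  show "\<forall>\<^sub>F n in sequentially.
      norm (real (card {Q. triangle_quadruple Q \<and> max_entry Q \<le> n}))
        \<le> 648 * norm ((real n)\<^sup>2 * (ln (real n)) ^ 3)"
    \<comment> \<open>From 3 on, \<open>n\<close> exceeds e, so the logarithmic factor is at least 1
      and the quadratic bound suffices.\<close>
    using eventually_ge_at_top[of 3]
  proof eventually_elim
    case (elim n)
    have "exp 1 \<le> real n" using exp_le elim by linarith
    then have "1 \<le> ln (real n)"
      using elim by (simp add: ln_ge_iff)
    then have "(real n)\<^sup>2 * 1 \<le> (real n)\<^sup>2 * (ln (real n)) ^ 3"
      by (intro mult_left_mono one_le_power) simp_all
    then have "648 * (real n)\<^sup>2 \<le> 648 * norm ((real n)\<^sup>2 * (ln (real n)) ^ 3)"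
      by simp
    moreover have "real (card {Q. triangle_quadruple Q \<and> max_entry Q \<le> n}) \<le> 648 * (real n)\<^sup>2"
      using elim by (intro card_triangle_quadruples_le) simp
    ultimately show ?case
      unfolding real_norm_def[of "real (card _)"] abs_of_nat by (rule order_trans[rotated])
  qed
qed

end
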